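(* Let $n$ be a positive integer and $m \in \mathbb{Z}$. Then there exists a positive integer $D$ such that the continued fraction expansion of $\sqrt{D}$ has period length $4$ and $D \equiv m \pmod n$.
   Context: For a positive integer $D$ that is not a perfect square, $\sqrt{D} = [a_0; \overline{a_1, \ldots, a_k}]$ is eventually periodic with $a_k = 2a_0$ and $(a_1,\dots,a_{k-1})$ a palindrome; the period length is the minimal such $k$. *)

theory Defs
  imports Complex_Main "HOL-Number_Theory.Cong"
begin

text \<open>
  The complete quotients \<open>x\<^sub>0 = x\<close>, \<open>x\<^sub>i\<^sub>+\<^sub>1 = 1 / (x\<^sub>i - \<lfloor>x\<^sub>i\<rfloor>)\<close> and the partial quotients
  \<open>a\<^sub>i = \<lfloor>x\<^sub>i\<rfloor>\<close> of the regular continued fraction \<open>x = [a\<^sub>0; a\<^sub>1, a\<^sub>2, \<dots>]\<close>.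
  For irrational \<open>x\<close> the expansion never terminates and no division by zero occurs; these
  are the only arguments for which the definitions are meant to be used.
\<close>

primrec cf_complete_quotient :: "real \<Rightarrow> nat \<Rightarrow> real" where
  "cf_complete_quotient x 0 = x"
| "cf_complete_quotient x (Suc i) = 1 / frac (cf_complete_quotient x i)"

definition cf_partial_quotient :: "real \<Rightarrow> nat \<Rightarrow> int" where
  "cf_partial_quotient x i = \<lfloor>cf_complete_quotient x i\<rfloor>"

text \<open>
  \<open>x = [a\<^sub>0; overline(a\<^sub>1, \<dots>, a\<^sub>k)]\<close>: only \<open>a\<^sub>0\<close> precedes the repeating block.  If \<open>x = sqrt D\<close>
  with \<open>D\<close> a non-square, such a \<open>k\<close> exists; the further properties \<open>a\<^sub>k = 2 a\<^sub>0\<close> and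
  \<open>(a\<^sub>1, \<dots>, a\<^sub>k\<^sub>-\<^sub>1)\<close> palindromic hold for every such \<open>k\<close>, so they are not part of the definition.
\<close>

definition cf_is_period :: "real \<Rightarrow> nat \<Rightarrow> bool" where
  "cf_is_period x k \<longleftrightarrow>
     k > 0 \<and> (\<forall>i\<ge>1. cf_partial_quotient x (i + k) = cf_partial_quotient x i)"

definition cf_period_length :: "real \<Rightarrow> nat" where
  "cf_period_length x = (LEAST k. cf_is_period x k)"

end

theory Submission
  imports Defs
begin

text \<open>
  If \<open>a (a b + 2) (D - c\<^sup>2) = 2 c (a b + 1) + b\<close>, then \<open>y = c + sqrt D\<close> is a fixed point of
  \<open>y \<mapsto> [2 c; a, b, a, y]\<close>, so \<open>sqrt D = [c; overline(a, b, a, 2 c)]\<close>, and the period is minimal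
  exactly when \<open>b \<noteq> 2 c\<close>.  The integral solutions are
  \<open>2 c = s a (a b + 2) - b (a b + 1)\<close> and \<open>D = c\<^sup>2 + s (a b + 1) - b\<^sup>2\<close> with \<open>s\<close> a free parameter.
  For \<open>a = n\<close> and \<open>b = 2 n\<close> both \<open>c\<close> and \<open>b\<close> vanish modulo \<open>n\<close>, and hence \<open>D \<equiv> s\<close>.
\<close>

lemma floor_int_add_inverse:
  fixes w :: real
  assumes "w > 1"
  shows "\<lfloor>of_int k + 1 / w\<rfloor> = k"
  using assms by (simp add: floor_eq_iff)

lemma inverse_frac_int_add_inverse:
  fixes w :: real
  assumes "w > 1"
  shows "1 / frac (of_int k + 1 / w) = w"
  using assms floor_int_add_inverse[OF assms, of k] by (simp add: frac_def)

lemma int_add_inverse_gt_1: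
  fixes w :: real
  assumes "k > 0" and "w > 1"
  shows "of_int k + 1 / w > 1"
proof -
  have "of_int k \<ge> (1 :: real)" "1 / w > 0" using assms by simp_all
  then show ?thesis by linarith
qed

text \<open>The recursion computes each complete quotient from its predecessor alone, so a single
  coincidence propagates to all later indices.\<close>

lemma cf_complete_quotient_periodic:
  assumes "cf_complete_quotient x (i + k) = cf_complete_quotient x i" and "i \<le> j"
  shows "cf_complete_quotient x (j + k) = cf_complete_quotient x j"
  using assms(2,1) by (induction j rule: dec_induct) simp_all

locale sqrt_period_four =
  fixes a b c :: int and D :: nat
  assumes pos: "a > 0" "b > 0" "c > 0"
    and eq: "a * (a * b + 2) * (int D - c\<^sup>2) = 2 * c * (a * b + 1) + b"
begin

text \<open>The candidates for the complete quotients, built backwards from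
  \<open>c + sqrt D\<close>. Splitting this as \<open>2 * c\<close> plus \<open>sqrt D - c\<close>
  displays the last partial quotient and the tail \<open>1 / z\<^sub>1\<close>.\<close>

definition z\<^sub>4 :: real where "z\<^sub>4 = 2 * c + (sqrt D - c)"
definition z\<^sub>3 :: real where "z\<^sub>3 = a + 1 / z\<^sub>4"
definition z\<^sub>2 :: real where "z\<^sub>2 = b + 1 / z\<^sub>3"
definition z\<^sub>1 :: real where "z\<^sub>1 = a + 1 / z\<^sub>2"

lemma sqrt_eq: "sqrt D = c + 1 / z\<^sub>1"
  and z_gt_1: "z\<^sub>1 > 1" "z\<^sub>2 > 1" "z\<^sub>3 > 1" "z\<^sub>4 > 1"
proof -
  define A B C r where "A = real_of_int a" and "B = real_of_int b" and "C = real_of_int c"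
    and "r = sqrt D"
  have p: "A \<ge> 1" "B \<ge> 1" "C \<ge> 1" "r \<ge> 0"
    using pos by (simp_all add: A_def B_def C_def r_def)
  \<comment> \<open>Together with \<open>c \<ge> 1\<close>, strict positivity of
    \<open>sqrt D\<close> yields \<open>z\<^sub>4 = sqrt D + c > 1\<close>.\<close>
  have "D \<noteq> 0"
  proof
    assume "D = 0"
    then have "a * (a * b + 2) * (- c\<^sup>2) > 0"
      using eq pos by (simp add: add_pos_pos)
    moreover have "a * (a * b + 2) * c\<^sup>2 > 0"
      using pos by (simp add: add_pos_pos)
    ultimately show False by simp
  qed
  then have r: "r > 0" by (simp add: r_def)
  show 4: "z\<^sub>4 > 1" using p r unfolding z\<^sub>4_def C_def[symmetric] r_def[symmetric] of_int_mult by simp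
  then show 3: "z\<^sub>3 > 1" using pos by (simp add: z\<^sub>3_def int_add_inverse_gt_1)
  then show 2: "z\<^sub>2 > 1" using pos by (simp add: z\<^sub>2_def int_add_inverse_gt_1)
  then show "z\<^sub>1 > 1" using pos by (simp add: z\<^sub>1_def int_add_inverse_gt_1)
  have "real_of_int (a * (a * b + 2) * (int D - c\<^sup>2)) = real_of_int (2 * c * (a * b + 1) + b)"
    using eq by (simp only:)
  then have E: "A * (A * B + 2) * (r\<^sup>2 - C\<^sup>2) = 2 * C * (A * B + 1) + B"
    by (simp add: A_def B_def C_def r_def)
  have z4: "z\<^sub>4 = r + C" by (simp add: z\<^sub>4_def r_def C_def)
  define y where "y = r + C"
  have y: "y > 0" using p r by (simp add: y_def)
  have d: "A * y + 1 > 0" "(A * B + 1) * y + B > 0" "A * (A * B + 2) * y + (A * B + 1) > 0"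
    using p y by (auto intro!: add_pos_pos mult_pos_pos)
  have "z\<^sub>3 = (A * y + 1) / y"
    using y by (simp add: z\<^sub>3_def A_def z4 y_def field_simps)
  then have "z\<^sub>2 = ((A * B + 1) * y + B) / (A * y + 1)"
    using d(1) by (simp add: z\<^sub>2_def B_def field_simps)
  then have "z\<^sub>1 = (A * (A * B + 2) * y + (A * B + 1)) / ((A * B + 1) * y + B)"
    using d(2) by (simp add: z\<^sub>1_def A_def[symmetric] field_simps)
  \<comment> \<open>This is \<open>1 / z\<^sub>1 = r - C\<close> with denominators cleared: the
    terms linear in \<open>r\<close> cancel, and what remains is \<open>E\<close>.\<close>
  moreover have "(r - C) * (A * (A * B + 2) * y + (A * B + 1)) = (A * B + 1) * y + B"
    using E unfolding y_def by algebra
  ultimately have "1 / z\<^sub>1 = r - C"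
    using d(3) by (simp add: field_simps)
  then show "sqrt D = c + 1 / z\<^sub>1" by (simp add: r_def C_def)
qed

lemma z\<^sub>4_eq: "z\<^sub>4 = of_int (2 * c) + 1 / z\<^sub>1"
  using sqrt_eq by (simp add: z\<^sub>4_def)

lemma cf_complete_quotients:
  "cf_complete_quotient (sqrt D) 1 = z\<^sub>1"
  "cf_complete_quotient (sqrt D) 2 = z\<^sub>2"
  "cf_complete_quotient (sqrt D) 3 = z\<^sub>3"
  "cf_complete_quotient (sqrt D) 4 = z\<^sub>4"
  "cf_complete_quotient (sqrt D) 5 = z\<^sub>1"
proof -
  show 1: "cf_complete_quotient (sqrt D) 1 = z\<^sub>1"
    using inverse_frac_int_add_inverse[OF z_gt_1(1), of c] by (simp add: sqrt_eq)
  show 2: "cf_complete_quotient (sqrt D) 2 = z\<^sub>2"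
    using 1 inverse_frac_int_add_inverse[OF z_gt_1(2), of a]
    by (simp add: z\<^sub>1_def numeral_2_eq_2)
  show 3: "cf_complete_quotient (sqrt D) 3 = z\<^sub>3"
    using 2 inverse_frac_int_add_inverse[OF z_gt_1(3), of b]
    by (simp add: z\<^sub>2_def eval_nat_numeral)
  show 4: "cf_complete_quotient (sqrt D) 4 = z\<^sub>4"
    using 3 inverse_frac_int_add_inverse[OF z_gt_1(4), of a]
    by (simp add: z\<^sub>3_def eval_nat_numeral)
  show "cf_complete_quotient (sqrt D) 5 = z\<^sub>1"
    using 4 inverse_frac_int_add_inverse[OF z_gt_1(1), of "2 * c"]
    by (simp add: z\<^sub>4_eq eval_nat_numeral)
qed

lemma cf_partial_quotients:
  "cf_partial_quotient (sqrt D) 1 = a"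
  "cf_partial_quotient (sqrt D) 2 = b"
  "cf_partial_quotient (sqrt D) 3 = a"
  "cf_partial_quotient (sqrt D) 4 = 2 * c"
  "cf_partial_quotient (sqrt D) 5 = a"
  unfolding cf_partial_quotient_def cf_complete_quotients
  using floor_int_add_inverse z_gt_1 z\<^sub>1_def z\<^sub>2_def z\<^sub>3_def z\<^sub>4_eq by metis+

lemma cf_is_period_4: "cf_is_period (sqrt D) 4"
  unfolding cf_is_period_def cf_partial_quotient_def
  using cf_complete_quotient_periodic[of "sqrt D" 1 4] cf_complete_quotients(1,5) by simp

lemma cf_period_length_eq_4:
  assumes "b \<noteq> 2 * c"
  shows "cf_period_length (sqrt D) = 4"
  unfolding cf_period_length_def
proof (rule Least_equality[where P = "cf_is_period (sqrt D)", OF cf_is_period_4])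
  fix k assume k: "cf_is_period (sqrt D) k"
  let ?q = "cf_partial_quotient (sqrt D)"
  have shift: "?q (i + k) = ?q i" if "i \<ge> 1" for i
    using k that by (simp add: cf_is_period_def)
  show "4 \<le> k"
  proof (rule ccontr)
    assume "\<not> 4 \<le> k"
    moreover have "k > 0" using k by (simp add: cf_is_period_def)
    ultimately consider "k = 1" | "k = 2" | "k = 3" by linarith
    \<comment> \<open>The partial quotients from index 1 on start \<open>a, b, a, 2 * c, a\<close>.
      Shift 2 compares \<open>b\<close> with \<open>2 * c\<close> directly; shifts 1 and 3 each
      force \<open>b = a\<close> and \<open>a = 2 * c\<close>.\<close>
    then have "b = 2 * c"
      by cases (use shift[of 1] shift[of 2] shift[of 3] cf_partial_quotients in simp_all)
    with assms show False by simp
  qed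
qed

text \<open>A square would make \<open>1 / z\<^sub>1 = sqrt D - c\<close> an integer strictly
  between 0 and 1.\<close>

lemma not_square: "\<not> (\<exists>k::nat. D = k\<^sup>2)"
proof
  assume "\<exists>k::nat. D = k\<^sup>2"
  then obtain k :: nat where "sqrt D = real k" by auto
  with sqrt_eq have k: "1 / z\<^sub>1 = of_int (int k - c)" by simp
  have "0 < 1 / z\<^sub>1" "1 / z\<^sub>1 < 1" using z_gt_1(1) by simp_all
  then show False unfolding k by (simp only: of_int_0_less_iff of_int_less_1_iff)
qed

end

theorem theorem2p3:
  fixes n :: nat and m :: int
  assumes "n > 0"
  shows "\<exists>D::nat. D > 0 \<and> \<not> (\<exists>k::nat. D = k\<^sup>2) \<and>
           cf_period_length (sqrt (real D)) = 4 \<and> [int D = m] (mod (int n))"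
proof -
  define N where "N = int n"
  \<comment> \<open>Adding \<open>3 * N\<close> keeps the residue of \<open>m\<close> and forces
    \<open>s \<ge> 3\<close>, large enough for \<open>c > N\<close> and
    \<open>d > 0\<close>.\<close>
  define s where "s = m mod N + 3 * N"
  define c where "c = s * (N * (N\<^sup>2 + 1)) - N * (2 * N\<^sup>2 + 1)"
  define d where "d = c\<^sup>2 + s * (2 * N\<^sup>2 + 1) - 4 * N\<^sup>2"
  have N: "N > 0" using assms by (simp add: N_def)
  then have s: "s \<ge> 3" by (simp add: s_def add_increasing)
  have "s * (N * (N\<^sup>2 + 1)) \<ge> 3 * (N * (N\<^sup>2 + 1))"
    using s N by (intro mult_right_mono) auto
  moreover have "N * (N\<^sup>2 + 1) = N ^ 3 + N" "N * (2 * N\<^sup>2 + 1) = 2 * N ^ 3 + N" "N ^ 3 > 0"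
    using N by (simp_all add: algebra_simps power2_eq_square power3_eq_cube)
  \<comment> \<open>In fact \<open>c \<ge> N ^ 3 + 2 * N\<close>. The bound \<open>c > N\<close>
    gives both \<open>c > 0\<close> and \<open>2 * N \<noteq> 2 * c\<close>, the condition for
    minimality of the period.\<close>
  ultimately have c: "c > N"
    using N unfolding c_def by linarith
  have "4 * N\<^sup>2 < 3 * (2 * N\<^sup>2 + 1)"
    by (simp add: add_nonneg_pos)
  also have "\<dots> \<le> s * (2 * N\<^sup>2 + 1)"
    using s by (intro mult_right_mono) auto
  finally have "s * (2 * N\<^sup>2 + 1) - 4 * N\<^sup>2 > 0" by simp
  then have d: "d > 0"
    unfolding d_def using zero_le_power2[of c] by (metis add_diff_eq add_nonneg_pos)
  have "sqrt_period_four N (2 * N) c (nat d)"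
  proof
    show "N * (N * (2 * N) + 2) * (int (nat d) - c\<^sup>2) = 2 * c * (N * (2 * N) + 1) + 2 * N"
      using d unfolding d_def c_def by (simp add: algebra_simps power2_eq_square)
  qed (use N c in auto)
  then interpret sqrt_period_four N "2 * N" c "nat d" .
  have "s = m + N * (3 - m div N)"
    using mult_div_mod_eq[of N m] by (simp add: s_def algebra_simps)
  \<comment> \<open>\<open>N\<close> divides \<open>c\<close>, so modulo \<open>N\<close> only the
    summand \<open>s\<close> of \<open>d\<close> survives.\<close>
  moreover have "d = s + N * (N * (s * (N\<^sup>2 + 1) - (2 * N\<^sup>2 + 1))\<^sup>2 + 2 * s * N - 4 * N)"
    unfolding d_def c_def by algebra
  ultimately have "d - m = N * (N * (s * (N\<^sup>2 + 1) - (2 * N\<^sup>2 + 1))\<^sup>2 + 2 * s * N - 4 * N + 3 - m div N)"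
    by (simp add: algebra_simps)
  then have "[d = m] (mod N)"
    unfolding cong_iff_dvd_diff by (metis dvd_triv_left)
  with d c not_square cf_period_length_eq_4 show ?thesis
    by (intro exI[of _ "nat d"]) (simp add: N_def)
qed

end
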